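(* Let $N$ and $p$ be positive integers and let $\hat{x}_{p+1}=(x_1,x_2,\dots,x_{p+1})$ and $\hat{y}_p=(y_1,y_2,\dots,y_p)$ be such that $$z=x_1+x_2+\cdots+x_{p+1}=y_1+y_2+\cdots+y_p.$$ Then for every integer $n\ge 0$, $$S_{N,n}^{(p+1)}(\hat{x}_{p+1})=\frac{1}{pN}\left[(pN-n)\,S_{N,n}^{(p)}(\hat{y}_p)+n(z-p)\,S_{N,n-1}^{(p)}(\hat{y}_p)\right].$$
   Context: For a positive integer $N$, the hypergeometric Bernoulli polynomials $B_{N,n}(x)$ of order $N$ are defined by $$\frac{(t^N/N!)\,e^{xt}}{e^t-T_{N-1}(t)}=\sum_{n=0}^\infty B_{N,n}(x)\frac{t^n}{n!},\qquad T_{N-1}(t)=\sum_{m=0}^{N-1}\frac{t^m}{m!}.$$ For a positive integer $p$ and $\hat{x}_p=(x_1,\dots,x_p)$, the sums of products of order $p$ are $$S_{N,n}^{(p)}(\hat{x}_p)=\sum_{i_1+i_2+\cdots+i_p=n}\frac{n!}{i_1!\,i_2!\cdots i_p!}B_{N,i_1}(x_1)B_{N,i_2}(x_2)\cdots B_{N,i_p}(x_p),$$ the sum running over nonnegative integers $i_1,\dots,i_p$, and $S_{N,n}^{(p)}(\hat{x}_p)=0$ for $n<0$. *)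

theory Defs
  imports Complex_Main "HOL-Computational_Algebra.Formal_Power_Series" "HOL-Library.FuncSet"
begin

definition exp_trunc :: "nat \<Rightarrow> 'a :: field_char_0 fps" where
  "exp_trunc N = (\<Sum>m<N. fps_const (1 / fact m) * fps_X ^ m)"

text \<open>
  Both the numerator and the denominator have subdegree \<open>N\<close>, so the quotient of formal power
  series taken here is exact; see \<open>hyp_bernoulli_gen_fun\<close> below. The argument ranges over an
  arbitrary field of characteristic zero (e.g. the real or complex numbers, or a field of
  rational functions when the arguments are indeterminates).
\<close>

definition hyp_bernoulli :: "nat \<Rightarrow> nat \<Rightarrow> 'a :: field_char_0 \<Rightarrow> 'a" where
  "hyp_bernoulli N n x =
     fact n * fps_nth ((fps_const (1 / fact N) * fps_X ^ N * fps_exp x) /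
                       (fps_exp 1 - exp_trunc N)) n"

text \<open>
  The arguments \<open>x\<^sub>1, \<dots>, x\<^sub>p\<close> are given by a function of which only the values on \<open>{1..p}\<close>
  matter; the summation tuples are extensional functions on \<open>{1..p}\<close>, so that each tuple is
  counted exactly once.
\<close>

definition sum_prod :: "nat \<Rightarrow> nat \<Rightarrow> int \<Rightarrow> (nat \<Rightarrow> 'a :: field_char_0) \<Rightarrow> 'a" where
  "sum_prod N p n x =
     (if n < 0 then 0
      else \<Sum>i \<in> {i \<in> {1..p} \<rightarrow>\<^sub>E (UNIV :: nat set). (\<Sum>j=1..p. i j) = nat n}.
             fact (nat n) / (\<Prod>j=1..p. fact (i j)) * (\<Prod>j=1..p. hyp_bernoulli N (i j) (x j)))"

lemma exp_trunc_nth: "fps_nth (exp_trunc N) n = (if n < N then 1 / fact n else 0)"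
proof -
  have "fps_nth (exp_trunc N) n = (\<Sum>m<N. if n = m then 1 / fact m else (0::'a))"
    unfolding exp_trunc_def fps_sum_nth
    by (intro sum.cong refl) (auto simp: fps_X_power_iff)
  then show ?thesis
    by simp
qed

lemma subdegree_exp_minus_exp_trunc:
  "subdegree (fps_exp 1 - exp_trunc N :: 'a :: field_char_0 fps) = N"
  by (rule subdegreeI) (auto simp: exp_trunc_nth)

lemma exp_minus_exp_trunc_nonzero: "fps_exp 1 - exp_trunc N \<noteq> (0 :: 'a :: field_char_0 fps)"
proof
  assume "fps_exp 1 - exp_trunc N = (0 :: 'a fps)"
  then have "fps_nth (fps_exp 1 - exp_trunc N :: 'a fps) N = 0"
    by simp
  then show False
    by (simp add: exp_trunc_nth)
qed

lemma hyp_bernoulli_gen_fun: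
  fixes x :: "'a :: field_char_0"
  shows "Abs_fps (\<lambda>n. hyp_bernoulli N n x / fact n) * (fps_exp 1 - exp_trunc N) =
         fps_const (1 / fact N) * fps_X ^ N * fps_exp x"
proof -
  let ?f = "fps_const (1 / fact N) * fps_X ^ N * fps_exp x"
  let ?g = "fps_exp 1 - exp_trunc N :: 'a fps"
  have eq: "Abs_fps (\<lambda>n. hyp_bernoulli N n x / fact n) = ?f / ?g"
    by (rule fps_ext) (simp add: hyp_bernoulli_def)
  have nth: "fps_nth ?f n = (if n < N then 0 else 1 / fact N * fps_nth (fps_exp x) (n - N))" for n
    by (simp add: mult.assoc fps_X_power_mult_nth)
  then have sub: "subdegree ?f = N"
    by (intro subdegreeI) auto
  have "fps_nth ?f N \<noteq> 0"
    by (simp add: nth)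
  then have "?f \<noteq> 0"
    by (metis fps_zero_nth)
  then have "?g dvd ?f"
    by (subst fps_dvd_iff) (simp_all only: exp_minus_exp_trunc_nonzero subdegree_exp_minus_exp_trunc
      sub not_False_eq_True order_refl simp_thms)
  then show ?thesis
    unfolding eq by (rule dvd_div_mult_self)
qed

lemma finite_sum_prod_index:
  fixes p n :: nat
  shows "finite {i \<in> {1..p} \<rightarrow>\<^sub>E (UNIV :: nat set). (\<Sum>j=1..p. i j) = n}"
proof (rule finite_subset)
  show "{i \<in> {1..p} \<rightarrow>\<^sub>E (UNIV :: nat set). (\<Sum>j=1..p. i j) = n} \<subseteq> {1..p} \<rightarrow>\<^sub>E {..n}"
  proof (intro subsetI, elim CollectE conjE, intro PiE_I)
    fix i :: "nat \<Rightarrow> nat" and j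
    assume "(\<Sum>j=1..p. i j) = n" "j \<in> {1..p}"
    then show "i j \<in> {..n}"
      using member_le_sum[of j "{1..p}" i] by auto
  qed (auto simp: PiE_iff extensional_def)
  show "finite ({1..p} \<rightarrow>\<^sub>E {..n})"
    by (intro finite_PiE) auto
qed

end

theory Submission
  imports Defs
begin

text \<open>
  Write \<open>B\<^sub>x(t)\<close> for the exponential generating function of \<open>B\<^sub>N\<^sub>,\<^sub>n(x)\<close>. The argument enters only
  through the factor \<open>e\<^sup>x\<^sup>t\<close>, so \<open>B\<^sub>x = G e\<^sup>x\<^sup>t\<close> with \<open>G = B\<^sub>0\<close>, and \<open>S\<^sup>(\<^sup>p\<^sup>)\<close> has the
  exponential generating function \<open>G\<^sup>p e\<^sup>z\<^sup>t\<close>, where \<open>z\<close> is the sum of the arguments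
  (\<open>sum_prod_eq_fps_nth\<close>). In particular it depends on the arguments only through \<open>z\<close>.

  The denominator \<open>D = e\<^sup>t - T\<^sub>N\<^sub>-\<^sub>1(t)\<close> and the numerator \<open>A = t\<^sup>N/N!\<close> of \<open>G\<close> satisfy
  \<open>t D' = t D + N A\<close> and \<open>t A' = N A\<close>; hence \<open>G\<close> satisfies the Riccati equation
  \<open>t G' = N G - t G - N G\<^sup>2\<close> (\<open>hyp_bernoulli_egf_riccati\<close>). The quadratic term is what produces an
  additional factor \<open>G\<close>: differentiating \<open>F\<^sub>p = G\<^sup>p e\<^sup>z\<^sup>t\<close> gives
  \<open>p N F\<^sub>p\<^sub>+\<^sub>1 = p N F\<^sub>p - t F\<^sub>p' + (z - p) t F\<^sub>p\<close>, and the theorem is the comparison of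
  coefficients in this identity.
\<close>

text \<open>
  This is \<open>fps_prod_nth'\<close>, a sum over multisets, in the indexing of \<open>sum_prod\<close>: a multiset
  supported in \<open>A\<close> is the same as its multiplicity function, made extensional on \<open>A\<close>.
\<close>

lemma fps_prod_nth_PiE:
  fixes F :: "'b \<Rightarrow> 'a :: comm_ring_1 fps"
  assumes "finite A"
  shows "fps_nth (\<Prod>j\<in>A. F j) n =
    (\<Sum>i \<in> {i \<in> A \<rightarrow>\<^sub>E (UNIV :: nat set). (\<Sum>j\<in>A. i j) = n}. \<Prod>j\<in>A. fps_nth (F j) (i j))"
  unfolding fps_prod_nth'[OF assms]
proof (rule sum.reindex_bij_witness[where j = "\<lambda>X. restrict (count X) A"
      and i = "\<lambda>i. \<Sum>j\<in>A. replicate_mset (i j) j"], goal_cases)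
  case (1 X)
  then have "set_mset X \<subseteq> A"
    by (simp add: multisets_of_size_def)
  then show ?case
    using assms by (intro multiset_eqI) (auto simp: count_sum count_eq_zero_iff)
next
  case (2 X)
  then have X: "set_mset X \<subseteq> A" "size X = n"
    by (auto simp: multisets_of_size_def)
  have "(\<Sum>j\<in>A. count X j) = size X"
    unfolding size_multiset_overloaded_eq using assms X(1)
    by (intro sum.mono_neutral_right) (auto simp: not_in_iff)
  then show ?case
    using X by simp
next
  case (3 i)
  then show ?case
    using assms by (auto simp: PiE_iff extensional_def fun_eq_iff restrict_def count_sum)
next
  case (4 i)
  then show ?case
    using assms by (auto simp: multisets_of_size_def set_mset_sum size_multiset_sum split: if_splits)
next
  case (5 X)
  show ?case
    by (intro prod.cong) auto
qed

definition hyp_bernoulli_egf :: "nat \<Rightarrow> 'a \<Rightarrow> 'a :: field_char_0 fps" where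
  "hyp_bernoulli_egf N x = Abs_fps (\<lambda>n. hyp_bernoulli N n x / fact n)"

lemma hyp_bernoulli_egf_eq:
  "hyp_bernoulli_egf N x = hyp_bernoulli_egf N 0 * fps_exp (x :: 'a :: field_char_0)"
proof -
  have "hyp_bernoulli_egf N x * (fps_exp 1 - exp_trunc N) =
        (hyp_bernoulli_egf N 0 * (fps_exp 1 - exp_trunc N)) * fps_exp x"
    unfolding hyp_bernoulli_egf_def hyp_bernoulli_gen_fun by simp
  then have "hyp_bernoulli_egf N x * (fps_exp 1 - exp_trunc N) =
        (hyp_bernoulli_egf N 0 * fps_exp x) * (fps_exp 1 - exp_trunc N)"
    by (simp only: mult_ac)
  then show ?thesis
    using exp_minus_exp_trunc_nonzero by (metis mult_right_cancel)
qed

lemma prod_fps_exp: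
  "(\<Prod>j\<in>A. fps_exp (x j)) = fps_exp (\<Sum>j\<in>A. x j :: 'a :: field_char_0)"
  by (induction A rule: infinite_finite_induct) (auto simp: fps_exp_add_mult)

lemma sum_prod_eq_fps_nth:
  fixes x :: "nat \<Rightarrow> 'a :: field_char_0"
  shows "sum_prod N p (int n) x =
    fact n * fps_nth (hyp_bernoulli_egf N 0 ^ p * fps_exp (\<Sum>j=1..p. x j)) n"
proof -
  have "hyp_bernoulli_egf N 0 ^ p * fps_exp (\<Sum>j=1..p. x j) =
      (\<Prod>j=1..p. hyp_bernoulli_egf N (x j))"
    unfolding hyp_bernoulli_egf_eq[of N "x _"] by (simp add: prod.distrib prod_fps_exp)
  also have "fps_nth \<dots> n =
      (\<Sum>i \<in> {i \<in> {1..p} \<rightarrow>\<^sub>E (UNIV :: nat set). (\<Sum>j=1..p. i j) = n}.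
         \<Prod>j=1..p. fps_nth (hyp_bernoulli_egf N (x j)) (i j))"
    by (rule fps_prod_nth_PiE) simp
  finally show ?thesis
    by (simp add: sum_prod_def hyp_bernoulli_egf_def sum_distrib_left prod_dividef)
qed

text \<open>
  Since \<open>T\<^sub>N\<^sub>-\<^sub>1' = T\<^sub>N\<^sub>-\<^sub>2\<close>, the derivative of the denominator exceeds the denominator by
  \<open>t\<^sup>N\<^sup>-\<^sup>1/(N-1)!\<close>. The factor \<open>t\<close> turns this into \<open>N\<close> times the numerator \<open>t\<^sup>N/N!\<close>.
\<close>

lemma fps_X_deriv_exp_minus_exp_trunc:
  "fps_X * fps_deriv (fps_exp 1 - exp_trunc N) =
     fps_X * (fps_exp 1 - exp_trunc N) +
     of_nat N * (fps_const (1 / fact N) * fps_X ^ N :: 'a :: field_char_0 fps)"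
proof (rule fps_ext)
  fix n
  have nth: "fps_nth (of_nat N * (fps_const (1 / fact N) * fps_X ^ N) :: 'a fps) n =
      (if n = N then of_nat N / fact N else 0)"
    by (simp add: fps_of_nat[symmetric] fps_X_power_nth del: fps_of_nat)
  have ratio: "of_nat (Suc k) / fact (Suc k) = (1 / fact k :: 'a)" for k
    by (simp add: fact_reduce del: of_nat_Suc)
  show "fps_nth (fps_X * fps_deriv (fps_exp 1 - exp_trunc N) :: 'a fps) n =
     fps_nth (fps_X * (fps_exp 1 - exp_trunc N) +
     of_nat N * (fps_const (1 / fact N) * fps_X ^ N)) n"
  proof (cases n)
    case (Suc k)
    consider "Suc k < N" | "N = Suc k" | "N < Suc k"
      by linarith
    then show ?thesis
      unfolding fps_add_nth nth Suc
      by cases (use ratio[of k] in \<open>simp_all add: exp_trunc_nth right_diff_distrib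
        del: of_nat_Suc fact_Suc\<close>)
  qed (simp add: nth)
qed

text \<open>
  With \<open>A = G D\<close>, the two differential equations for \<open>A\<close> and \<open>D\<close> combine to an identity all of
  whose terms are divisible by \<open>D\<close>.
\<close>

lemma hyp_bernoulli_egf_riccati:
  fixes N :: nat
  defines "G \<equiv> (hyp_bernoulli_egf N 0 :: 'a :: field_char_0 fps)"
  shows "fps_X * fps_deriv G = of_nat N * G - fps_X * G - of_nat N * G ^ 2"
proof -
  define D :: "'a fps" where "D = fps_exp 1 - exp_trunc N"
  define A :: "'a fps" where "A = fps_const (1 / fact N) * fps_X ^ N"
  have GD: "G * D = A"
    using hyp_bernoulli_gen_fun[of N "0 :: 'a"]
    by (simp add: G_def D_def A_def hyp_bernoulli_egf_def)
  have D': "fps_X * fps_deriv D = fps_X * D + of_nat N * A"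
    unfolding D_def A_def by (rule fps_X_deriv_exp_minus_exp_trunc)
  have A': "fps_X * fps_deriv A = of_nat N * A"
    by (simp add: A_def fps_deriv_power')
      (cases N; simp add: mult_ac del: of_nat_Suc fact_Suc)
  have "(fps_X * fps_deriv G) * D = fps_X * fps_deriv (G * D) - G * (fps_X * fps_deriv D)"
    by (simp add: algebra_simps)
  also have "\<dots> = (of_nat N * G - fps_X * G - of_nat N * G ^ 2) * D"
    unfolding D' GD A' by (simp add: GD[symmetric] algebra_simps power2_eq_square)
  finally show ?thesis
    using exp_minus_exp_trunc_nonzero unfolding D_def by (metis mult_right_cancel)
qed

text \<open>
  Raising the power: the derivative of \<open>G\<^sup>p e\<^sup>z\<^sup>t\<close> contains \<open>p G\<^sup>p\<^sup>-\<^sup>1 t G'\<close>, and the Riccati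
  equation expresses \<open>t G'\<close> through \<open>G\<close> and \<open>G\<^sup>2\<close> only; the square yields \<open>G\<^sup>p\<^sup>+\<^sup>1\<close>.
\<close>

lemma hyp_bernoulli_egf_power_Suc:
  fixes z :: "'a :: field_char_0" and N :: nat
  defines "F \<equiv> \<lambda>p. hyp_bernoulli_egf N 0 ^ p * fps_exp z"
  shows "of_nat (p * N) * F (Suc p) =
    of_nat (p * N) * F p - fps_X * fps_deriv (F p) + fps_const (z - of_nat p) * (fps_X * F p)"
proof (cases p)
  case 0
  then show ?thesis by (simp add: F_def algebra_simps)
next
  case (Suc q)
  let ?G = "hyp_bernoulli_egf N 0 :: 'a fps" and ?E = "fps_exp z"
  have "fps_deriv (?G ^ p) = of_nat p * fps_deriv ?G * ?G ^ q"
    by (simp only: fps_deriv_power' Suc diff_Suc_1)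
  then have "fps_X * fps_deriv (F p) =
      of_nat p * ?G ^ q * ?E * (fps_X * fps_deriv ?G) + fps_const z * (fps_X * F p)"
    by (simp add: F_def algebra_simps)
  also have "fps_X * fps_deriv ?G = of_nat N * ?G - fps_X * ?G - of_nat N * ?G ^ 2"
    by (rule hyp_bernoulli_egf_riccati)
  finally have deriv: "fps_X * fps_deriv (F p) =
      of_nat p * ?G ^ q * ?E * (of_nat N * ?G - fps_X * ?G - of_nat N * ?G ^ 2) +
      fps_const z * (fps_X * F p)" .
  have const: "fps_const (z - of_nat p) = fps_const z - of_nat p"
    by (simp flip: fps_of_nat fps_const_sub)
  show ?thesis
    unfolding deriv const
    by (simp add: F_def Suc algebra_simps power2_eq_square)
qed

theorem theorem17:
  fixes N p :: nat and n :: int and x y :: "nat \<Rightarrow> 'a :: field_char_0" and z :: 'a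
  assumes "N \<ge> 1" and "p \<ge> 1"
    and "z = (\<Sum>j=1..p + 1. x j)" and "z = (\<Sum>j=1..p. y j)"
    and "n \<ge> 0"
  shows "sum_prod N (p + 1) n x =
    1 / (of_nat p * of_nat N) *
      ((of_nat p * of_nat N - of_int n) * sum_prod N p n y
       + of_int n * (z - of_nat p) * sum_prod N p (n - 1) y)"
proof -
  define F :: "nat \<Rightarrow> 'a fps" where "F = (\<lambda>p. hyp_bernoulli_egf N 0 ^ p * fps_exp z)"
  obtain m where m: "n = int m"
    using assms(5) nonneg_int_cases by blast
  have x: "sum_prod N (p + 1) n x = fact m * fps_nth (F (Suc p)) m"
    unfolding m F_def assms(3) using sum_prod_eq_fps_nth[of N "p + 1" m x] by simp
  have y: "sum_prod N p (int k) y = fact k * fps_nth (F p) k" for k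
    unfolding F_def assms(4) by (rule sum_prod_eq_fps_nth)
  have "of_nat (p * N) * F (Suc p) =
      of_nat (p * N) * F p - fps_X * fps_deriv (F p) + fps_const (z - of_nat p) * (fps_X * F p)"
    unfolding F_def by (rule hyp_bernoulli_egf_power_Suc)
  from arg_cong[OF this, of "\<lambda>f. fps_nth f m"]
  have *: "of_nat (p * N) * fps_nth (F (Suc p)) m = of_nat (p * N) * fps_nth (F p) m
      - of_nat m * fps_nth (F p) m
      + (z - of_nat p) * (if m = 0 then 0 else fps_nth (F p) (m - 1))"
    unfolding fps_of_nat[symmetric]
    by (cases m) (simp_all del: of_nat_Suc of_nat_mult)
  \<comment> \<open>For \<open>m = 0\<close> the factor \<open>n\<close> absorbs the negative index.\<close>
  have shift: "of_int n * sum_prod N p (n - 1) y =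
      fact m * (if m = 0 then 0 else fps_nth (F p) (m - 1))"
  proof (cases m)
    case (Suc k)
    then have "n - 1 = int k" using m by simp
    then show ?thesis using y[of k] m Suc by (simp add: mult.assoc)
  qed (simp add: m)
  have "of_nat p * of_nat N * sum_prod N (p + 1) n x =
      fact m * (of_nat (p * N) * fps_nth (F (Suc p)) m)"
    unfolding x by simp
  also have "\<dots> = (of_nat p * of_nat N - of_int n) * sum_prod N p n y
      + (z - of_nat p) * (of_int n * sum_prod N p (n - 1) y)"
    unfolding * shift by (simp add: m y algebra_simps)
  finally show ?thesis
    using assms(1,2) by (simp add: field_simps del: of_nat_Suc)
qed

end
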